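(* Let $C$ be a cyclically ordered graph that contains $L_3$ and such that every edge of $C$ is a minedge or a bisuperedge. Then $sat_{\circlearrowright}(n,C)=\Theta(n)$.
   Context: A cyclically ordered graph is a finite simple graph whose vertex set is cyclically ordered. For vertices $u,x,v$ write $u<x<v$ if starting from $u$ and going clockwise one meets $x$ before $v$; the open interval $I_{u,v}$ is $\{x: u<x<v\}$. A cyclically ordered graph $H$ contains $C$ if there is an injective cyclic-order-preserving map $\varphi:V(C)\to V(H)$ with $\varphi(u)\varphi(v)\in E(H)$ for all $uv\in E(C)$; otherwise $H$ avoids $C$. $H$ saturates $C$ if $H$ avoids $C$ but adding any non-edge to $H$ yields a graph containing $C$. $sat_{\circlearrowright}(n,C)$ is the minimum number of edges of a cyclically ordered graph on $n$ vertices saturating $C$. An edge $uv$ of $C$ is a minedge if $I_{u,v}$ or $I_{v,u}$ is empty and both $u,v$ have degree one. An edge $uv$ of $C$ is a bisuperedge if both $I_{u,v}$ and $I_{v,u}$ contain both endpoints of some edge of $C$. $L_3$ is the cyclically ordered matching on vertex set $[6]$ (natural cyclic order) with edges $\{1,2\},\{3,4\},\{5,6\}$. *)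

theory Defs
  imports Complex_Main "HOL-Library.Landau_Symbols"
begin

text \<open>
  A (strict) cyclic order on \<open>V\<close>; \<open>R u x v\<close> is read as \<open>u < x < v\<close>: going clockwise from
  \<open>u\<close>, one meets \<open>x\<close> before \<open>v\<close>. Only the values of \<open>R\<close> on \<open>V\<close> matter, and \<open>R u x v\<close> forces
  \<open>u\<close>, \<open>x\<close>, \<open>v\<close> to be pairwise distinct.
\<close>

definition cyclic_order_on :: "'a set \<Rightarrow> ('a \<Rightarrow> 'a \<Rightarrow> 'a \<Rightarrow> bool) \<Rightarrow> bool" where
  "cyclic_order_on V R \<longleftrightarrow>
     (\<forall>a\<in>V. \<forall>b\<in>V. \<forall>c\<in>V. R a b c \<longrightarrow> R b c a) \<and>
     (\<forall>a\<in>V. \<forall>b\<in>V. \<forall>c\<in>V. R a b c \<longrightarrow> \<not> R c b a) \<and>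
     (\<forall>a\<in>V. \<forall>b\<in>V. \<forall>c\<in>V. \<forall>d\<in>V. R a b c \<longrightarrow> R a c d \<longrightarrow> R a b d) \<and>
     (\<forall>a\<in>V. \<forall>b\<in>V. \<forall>c\<in>V. a \<noteq> b \<longrightarrow> b \<noteq> c \<longrightarrow> a \<noteq> c \<longrightarrow> R a b c \<or> R c b a)"

record 'a cograph =
  verts :: "'a set"
  cyc :: "'a \<Rightarrow> 'a \<Rightarrow> 'a \<Rightarrow> bool"
  edges :: "'a set set"

definition cyclically_ordered_graph :: "'a cograph \<Rightarrow> bool" where
  "cyclically_ordered_graph H \<longleftrightarrow>
     finite (verts H) \<and> cyclic_order_on (verts H) (cyc H) \<and>
     (\<forall>e\<in>edges H. \<exists>u\<in>verts H. \<exists>v\<in>verts H. u \<noteq> v \<and> e = {u, v})"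

definition open_interval :: "'a cograph \<Rightarrow> 'a \<Rightarrow> 'a \<Rightarrow> 'a set" where
  "open_interval H u v = {x \<in> verts H. cyc H u x v}"

definition degree :: "'a cograph \<Rightarrow> 'a \<Rightarrow> nat" where
  "degree H v = card {e \<in> edges H. v \<in> e}"

definition contains :: "'b cograph \<Rightarrow> 'a cograph \<Rightarrow> bool" where
  "contains H C \<longleftrightarrow>
     (\<exists>\<phi>. \<phi> ` verts C \<subseteq> verts H \<and> inj_on \<phi> (verts C) \<and>
       (\<forall>u\<in>verts C. \<forall>x\<in>verts C. \<forall>v\<in>verts C. cyc C u x v \<longrightarrow> cyc H (\<phi> u) (\<phi> x) (\<phi> v)) \<and>
       (\<forall>u\<in>verts C. \<forall>v\<in>verts C. {u, v} \<in> edges C \<longrightarrow> {\<phi> u, \<phi> v} \<in> edges H))"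

abbreviation avoids :: "'b cograph \<Rightarrow> 'a cograph \<Rightarrow> bool" where
  "avoids H C \<equiv> \<not> contains H C"

definition add_edge :: "'a cograph \<Rightarrow> 'a \<Rightarrow> 'a \<Rightarrow> 'a cograph" where
  "add_edge H u v = H\<lparr>edges := insert {u, v} (edges H)\<rparr>"

definition saturates :: "'b cograph \<Rightarrow> 'a cograph \<Rightarrow> bool" where
  "saturates H C \<longleftrightarrow> avoids H C \<and>
     (\<forall>u\<in>verts H. \<forall>v\<in>verts H. u \<noteq> v \<longrightarrow> {u, v} \<notin> edges H \<longrightarrow> contains (add_edge H u v) C)"

text \<open>
  The host graphs have natural numbers as vertices, with an arbitrary cyclic order. This loses
  nothing, since every finite cyclically ordered graph is isomorphic to one of these. The minimum
  is over a nonempty set as soon as \<open>C\<close> has an edge; see \<open>cyc_sat_attained\<close> below.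
\<close>

definition cyc_sat :: "nat \<Rightarrow> 'a cograph \<Rightarrow> nat" where
  "cyc_sat n C = (LEAST m. \<exists>H :: nat cograph.
     cyclically_ordered_graph H \<and> card (verts H) = n \<and> saturates H C \<and> card (edges H) = m)"

definition minedge :: "'a cograph \<Rightarrow> 'a \<Rightarrow> 'a \<Rightarrow> bool" where
  "minedge C u v \<longleftrightarrow> {u, v} \<in> edges C \<and>
     (open_interval C u v = {} \<or> open_interval C v u = {}) \<and>
     degree C u = 1 \<and> degree C v = 1"

definition bisuperedge :: "'a cograph \<Rightarrow> 'a \<Rightarrow> 'a \<Rightarrow> bool" where
  "bisuperedge C u v \<longleftrightarrow> {u, v} \<in> edges C \<and>
     (\<exists>e\<in>edges C. e \<subseteq> open_interval C u v) \<and> (\<exists>e\<in>edges C. e \<subseteq> open_interval C v u)"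

definition natural_cyc :: "nat \<Rightarrow> nat \<Rightarrow> nat \<Rightarrow> bool" where
  "natural_cyc a b c \<longleftrightarrow> a < b \<and> b < c \<or> b < c \<and> c < a \<or> c < a \<and> a < b"

definition L3 :: "nat cograph" where
  "L3 = \<lparr>verts = {1..6}, cyc = natural_cyc, edges = {{1, 2}, {3, 4}, {5, 6}}\<rparr>"

lemma cyclic_order_on_natural_cyc: "cyclic_order_on V natural_cyc"
  unfolding cyclic_order_on_def natural_cyc_def by (intro conjI ballI impI) auto

lemma cyclically_ordered_graph_L3: "cyclically_ordered_graph L3"
  unfolding cyclically_ordered_graph_def
proof (intro conjI)
  show "\<forall>e\<in>edges L3. \<exists>u\<in>verts L3. \<exists>v\<in>verts L3. u \<noteq> v \<and> e = {u, v}"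
  proof
    fix e assume "e \<in> edges L3"
    then consider "e = {1, 2}" | "e = {3, 4}" | "e = {5, 6}" by (auto simp: L3_def)
    then show "\<exists>u\<in>verts L3. \<exists>v\<in>verts L3. u \<noteq> v \<and> e = {u, v}"
    proof cases
      case 1 then show ?thesis by (intro bexI[of _ 1] bexI[of _ 2]) (auto simp: L3_def)
    next
      case 2 then show ?thesis by (intro bexI[of _ 3] bexI[of _ 4]) (auto simp: L3_def)
    next
      case 3 then show ?thesis by (intro bexI[of _ 5] bexI[of _ 6]) (auto simp: L3_def)
    qed
  qed
qed (simp_all add: L3_def cyclic_order_on_natural_cyc)

lemma cyc_sat_attained:
  assumes C: "cyclically_ordered_graph C" and ne: "edges C \<noteq> {}"
  shows "\<exists>H :: nat cograph. cyclically_ordered_graph H \<and> card (verts H) = n \<and>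
           saturates H C \<and> card (edges H) = cyc_sat n C"
proof -
  define G :: "nat set set \<Rightarrow> nat cograph"
    where "G E = \<lparr>verts = {..<n}, cyc = natural_cyc, edges = E\<rparr>" for E
  define A where "A = {E. cyclically_ordered_graph (G E) \<and> avoids (G E) C}"
  have "A \<subseteq> Pow (Pow {..<n})"
  proof
    fix E assume "E \<in> A"
    then have *: "\<forall>e\<in>E. \<exists>u\<in>{..<n}. \<exists>v\<in>{..<n}. u \<noteq> v \<and> e = {u, v}"
      by (simp add: A_def G_def cyclically_ordered_graph_def)
    show "E \<in> Pow (Pow {..<n})" using * by fast
  qed
  then have fin: "finite A"
    by (rule finite_subset) simp
  obtain e where e: "e \<in> edges C"
    using ne by (auto simp only: ex_in_conv[symmetric])
  moreover have "\<forall>e\<in>edges C. \<exists>u\<in>verts C. \<exists>v\<in>verts C. u \<noteq> v \<and> e = {u, v}"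
    using C unfolding cyclically_ordered_graph_def by (elim conjE)
  ultimately have "\<exists>u\<in>verts C. \<exists>v\<in>verts C. u \<noteq> v \<and> e = {u, v}"
    by (rule bspec[rotated])
  then obtain u v where uv: "u \<in> verts C" "v \<in> verts C" "e = {u, v}"
    by (elim bexE conjE)
  have "\<not> contains (G {}) C"
  proof
    assume "contains (G {}) C"
    then obtain \<phi> where
      "\<forall>u\<in>verts C. \<forall>v\<in>verts C. {u, v} \<in> edges C \<longrightarrow> {\<phi> u, \<phi> v} \<in> edges (G {})"
      unfolding contains_def by (elim exE conjE)
    then have "{\<phi> u, \<phi> v} \<in> edges (G {})"
      using uv e by simp
    then show False by (simp add: G_def)
  qed
  then have "{} \<in> A"
    by (simp add: A_def G_def cyclically_ordered_graph_def cyclic_order_on_natural_cyc)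
  then have "A \<noteq> {}" by (rule ex_in_conv[THEN iffD1, OF exI])
  then obtain E where E: "E \<in> A" and maxi: "\<forall>E'\<in>A. E \<subseteq> E' \<longrightarrow> E = E'"
    by (rule finite_has_maximal[OF fin, THEN bexE])
  have "saturates (G E) C"
    unfolding saturates_def
  proof (intro conjI ballI impI)
    show "avoids (G E) C" using E by (simp add: A_def)
  next
    fix u v assume uv: "u \<in> verts (G E)" "v \<in> verts (G E)" "u \<noteq> v" "{u, v} \<notin> edges (G E)"
    have eq: "add_edge (G E) u v = G (insert {u, v} E)"
      by (simp add: add_edge_def G_def)
    have "{u, v} \<notin> E" using uv(4) by (simp add: G_def)
    then have "E \<noteq> insert {u, v} E" by (metis insertI1)
    then have "insert {u, v} E \<notin> A"
      using maxi by (meson subset_insertI)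
    have "\<exists>a\<in>{..<n}. \<exists>b\<in>{..<n}. a \<noteq> b \<and> {u, v} = {a, b}"
      using uv(1-3) by (intro bexI[of _ u] bexI[of _ v]) (simp_all add: G_def)
    then have "cyclically_ordered_graph (G (insert {u, v} E))"
      using E by (simp add: A_def G_def cyclically_ordered_graph_def)
    with \<open>insert {u, v} E \<notin> A\<close> show "contains (add_edge (G E) u v) C"
      by (simp add: A_def eq)
  qed
  moreover have "cyclically_ordered_graph (G E)" "card (verts (G E)) = n"
    using E by (simp_all add: A_def G_def)
  ultimately have "\<exists>m. \<exists>H :: nat cograph. cyclically_ordered_graph H \<and> card (verts H) = n \<and>
      saturates H C \<and> card (edges H) = m"
    by blast
  then show ?thesis
    unfolding cyc_sat_def by (rule LeastI_ex)
qed

end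

theory Submission
  imports Defs
begin

text \<open>
  Upper bound: an edge of \<open>C\<close> spanning a shortest interval is not a bisuperedge, so \<open>C\<close> has a
  minedge \<open>ab\<close>. Delete \<open>a\<close> and \<open>b\<close> from \<open>C\<close> and fill the gap they leave with isolated vertices.
  The result has fewer edges than \<open>C\<close>, hence avoids \<open>C\<close>, but every new edge inside the gap
  completes a copy of \<open>C\<close>. So in a saturated extension every edge meets the bounded set \<open>C - {a, b}\<close>.

  Lower bound: a saturating graph \<open>H\<close> on at least two vertices has no isolated vertex. Suppose \<open>w\<close>
  were one, and let \<open>ab\<close> be an edge whose second endpoint \<open>b\<close> is met first when going clockwise
  from \<open>w\<close>. No edge lies strictly between \<open>w\<close> and \<open>b\<close>, so in the copy of \<open>C\<close> created by \<open>wb\<close> this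
  edge can only play a minedge with nothing between \<open>w\<close> and \<open>b\<close>; moving \<open>w\<close> to \<open>a\<close> then gives a
  copy of \<open>C\<close> in \<open>H\<close> itself.
\<close>

section \<open>Cutting a cyclic order open into a linear one\<close>

text \<open>Cutting the circle at \<open>a\<close> turns clockwise order into a linear order, and
  the rank of a vertex is the number of vertices met before it. Later arguments about intervals
  thereby become inequalities between natural numbers.\<close>

lemma cyclic_order_rank:
  assumes fin: "finite V" and cyc: "cyclic_order_on V R" and a: "a \<in> V"
  obtains f :: "'a \<Rightarrow> nat" where "f a = 0" "inj_on f V" "\<And>x. x \<in> V \<Longrightarrow> f x < card V"
    "\<And>x y z. x \<in> V \<Longrightarrow> y \<in> V \<Longrightarrow> z \<in> V \<Longrightarrow> R x y z \<longleftrightarrow> natural_cyc (f x) (f y) (f z)"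
proof -
  have rot: "R y z x" if "R x y z" "x \<in> V" "y \<in> V" "z \<in> V" for x y z
    using cyc that unfolding cyclic_order_on_def by blast
  have asym: "\<not> R z y x" if "R x y z" "x \<in> V" "y \<in> V" "z \<in> V" for x y z
    using cyc that unfolding cyclic_order_on_def by blast
  have trans: "R x y u" if "R x y z" "R x z u" "x \<in> V" "y \<in> V" "z \<in> V" "u \<in> V" for x y z u
    using cyc that unfolding cyclic_order_on_def by blast
  have total: "R x y z \<or> R z y x"
    if "x \<noteq> y" "y \<noteq> z" "x \<noteq> z" "x \<in> V" "y \<in> V" "z \<in> V" for x y z
    using cyc that unfolding cyclic_order_on_def by blast
  have distinct: "x \<noteq> y \<and> y \<noteq> z \<and> x \<noteq> z" if "R x y z" "x \<in> V" "y \<in> V" "z \<in> V" for x y z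
    using rot asym that by metis
  \<comment> \<open>The vertices met before \<open>x\<close> on the way from \<open>a\<close>. Since
    \<open>R\<close> forces distinct arguments, \<open>R a a x\<close> fails and \<open>a\<close>
    has to be added by hand; this keeps rank 0 for \<open>a\<close> alone.\<close>
  define P where "P x = {y \<in> V. y = a \<and> x \<noteq> a \<or> R a y x}" for x
  define f where "f x = card (P x)" for x
  have finP: "finite (P x)" for x
    using fin by (simp add: P_def)
  have Pa: "P a = {}"
    using distinct a by (auto simp: P_def)
  have fa: "f a = 0"
    by (simp add: f_def Pa)
  have pos: "0 < f x" if "x \<in> V" "x \<noteq> a" for x
  proof -
    have "a \<in> P x" using a that by (simp add: P_def)
    then show ?thesis unfolding f_def card_gt_0_iff using finP by blast
  qed
  have mono: "f x < f y" if "R a x y" "x \<in> V" "y \<in> V" for x y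
  proof -
    have "P x \<subseteq> P y"
      using that distinct[OF that(1) a that(2,3)] trans a by (auto simp: P_def)
    moreover have "x \<in> P y" "x \<notin> P x"
      using that distinct a by (auto simp: P_def)
    ultimately show ?thesis
      unfolding f_def using finP by (metis psubsetI psubset_card_mono)
  qed
  have less: "x = a \<or> R a x y" if "f x < f y" "x \<in> V" "y \<in> V" for x y
  proof (rule ccontr)
    assume *: "\<not> ?thesis"
    moreover have "y \<noteq> a" "x \<noteq> y" using that fa by auto
    ultimately have "R a y x" using total[of a x y] rot a that by metis
    then show False using mono that by fastforce
  qed
  have inj: "inj_on f V"
  proof (rule inj_onI)
    fix x y assume xy: "x \<in> V" "y \<in> V" "f x = f y"
    show "x = y"
    proof (rule ccontr)
      assume "x \<noteq> y"
      then have "x = a \<or> y = a \<or> R a x y \<or> R a y x"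
        using total[of a x y] rot a xy by metis
      with \<open>x \<noteq> y\<close> xy show False using pos mono fa by (metis less_irrefl)
    qed
  qed
  \<comment> \<open>Increasing triples suffice, because the three cases of
    \<open>natural_cyc\<close> are rotations of one another.\<close>
  have sorted: "R x y z" if "f x < f y" "f y < f z" "x \<in> V" "y \<in> V" "z \<in> V" for x y z
  proof -
    have "y \<noteq> a" using that fa by auto
    then have yz: "R a y z" using less that by blast
    from less[OF that(1)] that consider "x = a" | "R a x y" by blast
    then show ?thesis
    proof cases
      case 1 then show ?thesis using yz by simp
    next
      case 2
      \<comment> \<open>Transitivity needs a common first argument, so both triples are rotated to
        start at \<open>y\<close>.\<close>
      have "R y a x" using rot[OF rot[OF 2]] that a by blast
      moreover have "R y z a" using rot[OF yz] that a by blast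
      ultimately have "R y z x" using trans that a by blast
      then show ?thesis using rot that by blast
    qed
  qed
  have nat: "R x y z" if "natural_cyc (f x) (f y) (f z)" "x \<in> V" "y \<in> V" "z \<in> V" for x y z
    using that sorted rot unfolding natural_cyc_def by meson
  have iff: "R x y z \<longleftrightarrow> natural_cyc (f x) (f y) (f z)" if xyz: "x \<in> V" "y \<in> V" "z \<in> V" for x y z
  proof
    assume R: "R x y z"
    then have "f x \<noteq> f y" "f y \<noteq> f z" "f x \<noteq> f z"
      using distinct[OF R xyz] inj xyz by (auto dest: inj_onD)
    \<comment> \<open>Distinct ranks are cyclically ordered one way or the other; the wrong way
      would give \<open>R z y x\<close> by \<open>nat\<close>, against asymmetry.\<close>
    then have "natural_cyc (f x) (f y) (f z) \<or> natural_cyc (f z) (f y) (f x)"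
      unfolding natural_cyc_def by linarith
    then show "natural_cyc (f x) (f y) (f z)"
      using nat asym R xyz by blast
  qed (use nat xyz in blast)
  have lt: "f x < card V" if "x \<in> V" for x
  proof -
    have "x \<notin> P x" using distinct a that by (auto simp: P_def)
    then have "P x \<subset> V" using that by (auto simp: P_def)
    then show ?thesis unfolding f_def using fin by (rule psubset_card_mono[rotated])
  qed
  show thesis
    using that[OF fa inj lt iff] .
qed

section \<open>Edge counts and saturated extensions\<close>

lemma edgeE:
  assumes "cyclically_ordered_graph H" "e \<in> edges H"
  obtains u v where "u \<in> verts H" "v \<in> verts H" "u \<noteq> v" "e = {u, v}"
  using assms unfolding cyclically_ordered_graph_def by blast

lemma finite_edges:
  assumes "cyclically_ordered_graph H"
  shows "finite (edges H)"
proof (rule finite_subset)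
  show "edges H \<subseteq> Pow (verts H)"
  proof
    fix e assume "e \<in> edges H"
    with assms obtain u v where "u \<in> verts H" "v \<in> verts H" "e = {u, v}" by (rule edgeE)
    then show "e \<in> Pow (verts H)" by simp
  qed
  show "finite (Pow (verts H))"
    using assms by (simp add: cyclically_ordered_graph_def)
qed

text \<open>An injective map on vertices is injective on edges as well. Mostly used
  contrapositively: a graph with too few edges avoids \<open>C\<close>.\<close>

lemma card_edges_le_if_contains:
  assumes C: "cyclically_ordered_graph C" and fin: "finite (edges H)" and cont: "contains H C"
  shows "card (edges C) \<le> card (edges H)"
proof -
  obtain \<phi> where inj: "inj_on \<phi> (verts C)"
    and E: "\<forall>u\<in>verts C. \<forall>v\<in>verts C. {u, v} \<in> edges C \<longrightarrow> {\<phi> u, \<phi> v} \<in> edges H"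
    using cont unfolding contains_def by (elim exE conjE)
  have "edges C \<subseteq> Pow (verts C)"
    using C by (auto elim: edgeE)
  with inj have "inj_on ((`) \<phi>) (edges C)"
    by (meson inj_on_image_Pow inj_on_subset)
  moreover have "(`) \<phi> ` edges C \<subseteq> edges H"
  proof
    fix e' assume "e' \<in> (`) \<phi> ` edges C"
    then obtain e where "e \<in> edges C" "e' = \<phi> ` e" by blast
    moreover obtain u v where "u \<in> verts C" "v \<in> verts C" "e = {u, v}"
      using C \<open>e \<in> edges C\<close> by (rule edgeE)
    ultimately show "e' \<in> edges H" using E by simp
  qed
  ultimately show ?thesis
    using fin by (rule card_inj_on_le)
qed

text \<open>Supplies an edge of \<open>C\<close> to start from, and a further edge beside any given
  one.\<close>

lemma card_edges_ge_3_if_contains_L3: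
  assumes "cyclically_ordered_graph C" "contains C L3"
  shows "3 \<le> card (edges C)"
proof -
  have "card (edges L3) = 3"
    by (simp add: L3_def card_insert_if doubleton_eq_iff)
  then show ?thesis
    using card_edges_le_if_contains[OF cyclically_ordered_graph_L3 finite_edges] assms by metis
qed

text \<open>Take a maximal edge set among those that contain \<open>edges H\<close> and still avoid
  \<open>C\<close>. The prescribed edges survive, which is what the upper bound construction relies
  on.\<close>

lemma saturated_extension:
  assumes H: "cyclically_ordered_graph H" and av: "avoids H C"
  obtains E where "edges H \<subseteq> E" "cyclically_ordered_graph (H\<lparr>edges := E\<rparr>)"
    "saturates (H\<lparr>edges := E\<rparr>) C"
proof -
  let ?G = "\<lambda>E. H\<lparr>edges := E\<rparr>"
  define A where "A = {E. cyclically_ordered_graph (?G E) \<and> avoids (?G E) C}"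
  have "A \<subseteq> Pow (Pow (verts H))"
    by (auto simp: A_def elim!: edgeE)
  then have fin: "finite A"
    by (rule finite_subset) (use H in \<open>simp add: cyclically_ordered_graph_def\<close>)
  have "edges H \<in> A"
    using H av by (simp add: A_def)
  with fin obtain E where E: "E \<in> A" "edges H \<subseteq> E" and maxi: "\<And>F. F \<in> A \<Longrightarrow> E \<subseteq> F \<Longrightarrow> E = F"
    by (meson finite_has_maximal2)
  have "saturates (?G E) C"
    unfolding saturates_def
  proof (intro conjI ballI impI)
    show "avoids (?G E) C" using E by (simp add: A_def)
  next
    fix u v assume uv: "u \<in> verts (?G E)" "v \<in> verts (?G E)" "u \<noteq> v" "{u, v} \<notin> edges (?G E)"
    have "cyclically_ordered_graph (?G (insert {u, v} E))"
      using E uv unfolding A_def cyclically_ordered_graph_def by auto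
    moreover have "insert {u, v} E \<notin> A"
      using maxi[of "insert {u, v} E"] uv(4) by auto
    ultimately show "contains (add_edge (?G E) u v) C"
      by (simp add: A_def add_edge_def)
  qed
  with E that show thesis by (simp add: A_def)
qed

section \<open>Minedges and bisuperedges\<close>

lemma bisuperedge_commute: "bisuperedge C u v \<longleftrightarrow> bisuperedge C v u"
  by (auto simp: bisuperedge_def insert_commute)

lemma minedge_commute: "minedge C u v \<longleftrightarrow> minedge C v u"
  by (auto simp: minedge_def insert_commute)

text \<open>Lengths are measured after cutting the circle, so only the side of an edge not passing
  the cut is considered. That is enough: failing on one side already refutes
  \<open>bisuperedge\<close>.\<close>

lemma exists_edge_not_bisuperedge:
  assumes C: "cyclically_ordered_graph C" and ne: "edges C \<noteq> {}"
  obtains u v where "{u, v} \<in> edges C" "\<not> bisuperedge C u v"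
proof -
  obtain e where "e \<in> edges C" using ne by blast
  with C obtain p q where pq: "p \<in> verts C" "q \<in> verts C" "p \<noteq> q" "{p, q} \<in> edges C"
    by (metis edgeE)
  obtain f :: "'a \<Rightarrow> nat" where inj: "inj_on f (verts C)" and f: "\<And>x y z. x \<in> verts C \<Longrightarrow>
      y \<in> verts C \<Longrightarrow> z \<in> verts C \<Longrightarrow> cyc C x y z \<longleftrightarrow> natural_cyc (f x) (f y) (f z)"
    using C pq(1) cyclic_order_rank unfolding cyclically_ordered_graph_def by metis
  define Q where "Q = (\<lambda>(u, v). u \<in> verts C \<and> v \<in> verts C \<and> {u, v} \<in> edges C \<and> f u < f v)"
  have ex: "Q (u, v) \<or> Q (v, u)"
    if "u \<in> verts C" "v \<in> verts C" "u \<noteq> v" "{u, v} \<in> edges C" for u v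
  proof -
    have "f u \<noteq> f v" using that inj by (auto dest: inj_onD)
    then show ?thesis using that by (auto simp: Q_def insert_commute)
  qed
  \<comment> \<open>\<open>Q\<close> orients each edge by increasing rank, so the natural-number
    subtraction never truncates.\<close>
  obtain u v where uv: "Q (u, v)" and least: "\<And>x y. Q (x, y) \<Longrightarrow> f v - f u \<le> f y - f x"
    using ex_has_least_nat[of Q _ "\<lambda>(u, v). f v - f u"] ex[OF pq]
    by (metis (mono_tags, lifting) case_prod_conv surj_pair)
  have "\<not> bisuperedge C u v"
  proof
    assume "bisuperedge C u v"
    then obtain e where e: "e \<in> edges C" "e \<subseteq> open_interval C u v"
      by (auto simp: bisuperedge_def)
    obtain x y where xy: "x \<in> verts C" "y \<in> verts C" "x \<noteq> y" "e = {x, y}"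
      using C e(1) by (rule edgeE)
    have "natural_cyc (f u) (f x) (f v)" "natural_cyc (f u) (f y) (f v)"
      using e xy f uv by (auto simp: open_interval_def Q_def)
    then have "f u < f x" "f x < f v" "f u < f y" "f y < f v"
      using uv by (auto simp: natural_cyc_def Q_def)
    then show False
      using ex[of x y] least[of x y] least[of y x] xy e by auto
  qed
  with uv that show thesis by (auto simp: Q_def)
qed

text \<open>Because of this, an endpoint of a minedge can be moved or deleted without affecting any
  other edge.\<close>

lemma edges_at_minedge:
  assumes "minedge C u v" "e \<in> edges C" "u \<in> e \<or> v \<in> e"
  shows "e = {u, v}"
proof -
  have "e = {u, v}" if "w \<in> e" "w \<in> {u, v}" "degree C w = 1" for w
  proof -
    obtain e' where "{e \<in> edges C. w \<in> e} = {e'}"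
      using \<open>degree C w = 1\<close> unfolding degree_def by (rule card_1_singletonE)
    moreover have "e \<in> {e \<in> edges C. w \<in> e}" "{u, v} \<in> {e \<in> edges C. w \<in> e}"
      using assms(1,2) that by (simp_all add: minedge_def)
    ultimately show ?thesis by simp
  qed
  moreover have "degree C u = 1" "degree C v = 1"
    using assms(1) by (simp_all add: minedge_def)
  ultimately show ?thesis using assms(3) by blast
qed

section \<open>Linear lower bound\<close>

lemma no_isolated_vertex:
  fixes C :: "'a cograph" and H :: "'b cograph"
  assumes C: "cyclically_ordered_graph C" and C2: "2 \<le> card (edges C)"
    and edge: "\<And>u v. {u, v} \<in> edges C \<Longrightarrow> minedge C u v \<or> bisuperedge C u v"
    and H: "cyclically_ordered_graph H" and n: "2 \<le> card (verts H)" and sat: "saturates H C"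
    and w: "w \<in> verts H"
  shows "\<exists>e\<in>edges H. w \<in> e"
proof (rule ccontr)
  assume "\<not> ?thesis"
  then have iso: "w \<notin> e" if "e \<in> edges H" for e using that by blast
  have av: "avoids H C" and add: "\<And>u v. u \<in> verts H \<Longrightarrow> v \<in> verts H \<Longrightarrow> u \<noteq> v \<Longrightarrow>
      {u, v} \<notin> edges H \<Longrightarrow> contains (add_edge H u v) C"
    using sat by (auto simp: saturates_def)
  \<comment> \<open>Otherwise adding one edge would create a copy of \<open>C\<close> in a graph
    with a single edge, while \<open>C\<close> has at least two.\<close>
  have "edges H \<noteq> {}"
  proof
    assume empty: "edges H = {}"
    obtain u v where "u \<in> verts H" "v \<in> verts H" "u \<noteq> v"
      using n by (metis card_2_iff' obtain_subset_with_card_n subsetD)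
    with empty add have "contains (add_edge H u v) C" by simp
    from card_edges_le_if_contains[OF C _ this] empty C2 show False
      by (simp add: add_edge_def)
  qed
  then obtain p q where pq: "p \<in> verts H" "q \<in> verts H" "p \<noteq> q" "{p, q} \<in> edges H"
    using H by (metis edgeE ex_in_conv)
  \<comment> \<open>The circle is cut at \<open>w\<close>, so going clockwise from \<open>w\<close>
    means increasing rank.\<close>
  obtain f :: "'b \<Rightarrow> nat" where fw: "f w = 0" and inj: "inj_on f (verts H)"
    and f: "\<And>x y z. x \<in> verts H \<Longrightarrow> y \<in> verts H \<Longrightarrow> z \<in> verts H \<Longrightarrow>
      cyc H x y z \<longleftrightarrow> natural_cyc (f x) (f y) (f z)"
    using H w cyclic_order_rank unfolding cyclically_ordered_graph_def by metis
  have pos: "0 < f x" if "x \<in> verts H" "x \<noteq> w" for x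
    using inj w fw that by (metis gr0I inj_onD)
  define Q where "Q = (\<lambda>(a, b). a \<in> verts H \<and> b \<in> verts H \<and> {a, b} \<in> edges H \<and> f a < f b)"
  have ex: "Q (u, v) \<or> Q (v, u)"
    if "u \<in> verts H" "v \<in> verts H" "u \<noteq> v" "{u, v} \<in> edges H" for u v
  proof -
    have "f u \<noteq> f v" using that inj by (auto dest: inj_onD)
    then show ?thesis using that by (auto simp: Q_def insert_commute)
  qed
  \<comment> \<open>Minimality of \<open>f b\<close> says that no edge of \<open>H\<close> has both
    endpoints of rank below \<open>f b\<close>.\<close>
  obtain a b where ab: "Q (a, b)" and least: "\<And>x y. Q (x, y) \<Longrightarrow> f b \<le> f y"
    using ex_has_least_nat[of Q _ "\<lambda>(u, v). f v"] ex[OF pq]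
    by (metis (mono_tags, lifting) case_prod_conv surj_pair)
  have b: "b \<in> verts H" and a: "a \<in> verts H" and fab: "f a < f b" and Eab: "{a, b} \<in> edges H"
    using ab by (auto simp: Q_def)
  have bw: "b \<noteq> w" using iso[OF Eab] by auto
  have "{w, b} \<notin> edges H" using iso by blast
  with add w b bw have "contains (add_edge H w b) C" by blast
  then obtain \<phi> where imB: "\<forall>x\<in>verts C. \<phi> x \<in> verts H" and inj\<phi>: "inj_on \<phi> (verts C)"
    and ordB: "\<forall>x\<in>verts C. \<forall>y\<in>verts C. \<forall>z\<in>verts C. cyc C x y z \<longrightarrow> cyc H (\<phi> x) (\<phi> y) (\<phi> z)"
    and EB: "\<forall>x\<in>verts C. \<forall>y\<in>verts C. {x, y} \<in> edges C \<longrightarrow>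
      {\<phi> x, \<phi> y} = {w, b} \<or> {\<phi> x, \<phi> y} \<in> edges H"
    unfolding contains_def add_edge_def by (simp add: image_subset_iff) blast
  have im: "\<phi> x \<in> verts H" if "x \<in> verts C" for x
    using imB that by blast
  have ord: "cyc H (\<phi> x) (\<phi> y) (\<phi> z)"
    if "x \<in> verts C" "y \<in> verts C" "z \<in> verts C" "cyc C x y z" for x y z
    using ordB that by blast
  have E\<phi>: "{\<phi> x, \<phi> y} = {w, b} \<or> {\<phi> x, \<phi> y} \<in> edges H"
    if "x \<in> verts C" "y \<in> verts C" "{x, y} \<in> edges C" for x y
    using EB that by blast
  have "\<exists>u\<in>verts C. \<exists>v\<in>verts C. {u, v} \<in> edges C \<and> {\<phi> u, \<phi> v} = {w, b}"
  proof (rule ccontr)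
    assume none: "\<not> ?thesis"
    have "{\<phi> x, \<phi> y} \<in> edges H" if "x \<in> verts C" "y \<in> verts C" "{x, y} \<in> edges C" for x y
    proof -
      have "{\<phi> x, \<phi> y} \<noteq> {w, b}" using none that by blast
      with E\<phi>[OF that] show ?thesis by simp
    qed
    with imB inj\<phi> ordB have "contains H C"
      unfolding contains_def by (intro exI[of _ \<phi>]) (simp add: image_subset_iff)
    with av show False by simp
  qed
  then obtain x y where xy: "x \<in> verts C" "y \<in> verts C" "{x, y} \<in> edges C"
    "{\<phi> x, \<phi> y} = {w, b}"
    by (elim bexE conjE)
  then obtain u v where u: "u \<in> verts C" and v: "v \<in> verts C" and Euv: "{u, v} \<in> edges C"
    and \<phi>u: "\<phi> u = w" and \<phi>v: "\<phi> v = b"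
    using that[of x y] that[of y x] by (auto simp: doubleton_eq_iff insert_commute)
  \<comment> \<open>Such an edge would be mapped to two vertices of rank below \<open>f b\<close>.
    Its image is then not the new edge \<open>{w, b}\<close>, so it is an edge of \<open>H\<close>
    contradicting the choice of \<open>b\<close>.\<close>
  have none: False if e: "e \<in> edges C" "e \<subseteq> open_interval C u v" for e
  proof -
    obtain x y where xy: "x \<in> verts C" "y \<in> verts C" "x \<noteq> y" "e = {x, y}"
      using C e(1) by (rule edgeE)
    have "natural_cyc (f w) (f (\<phi> x)) (f b)" "natural_cyc (f w) (f (\<phi> y)) (f b)"
      using e xy ord[OF u _ v] f w b im \<phi>u \<phi>v by (auto simp: open_interval_def)
    then have lt: "f (\<phi> x) < f b" "f (\<phi> y) < f b"
      by (auto simp: natural_cyc_def fw)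
    then have "{\<phi> x, \<phi> y} \<in> edges H"
      using E\<phi> xy e(1) by (metis doubleton_eq_iff less_irrefl)
    moreover have "\<phi> x \<noteq> \<phi> y" using inj\<phi> xy by (auto dest: inj_onD)
    ultimately show False
      using ex[of "\<phi> x" "\<phi> y"] least[of "\<phi> x" "\<phi> y"] least[of "\<phi> y" "\<phi> x"] lt im xy by auto
  qed
  with edge[OF Euv] have min: "minedge C u v" by (auto simp: bisuperedge_def)
  have uv: "u \<noteq> v" using \<phi>u \<phi>v bw by auto
  have order: "cyc C u x v \<or> cyc C v x u" if "x \<in> verts C" "x \<noteq> u" "x \<noteq> v" for x
    using C that u v uv unfolding cyclically_ordered_graph_def cyclic_order_on_def by metis
  \<comment> \<open>A minedge may have either side empty. If this one were empty, a second edge,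
    which misses \<open>u\<close> and \<open>v\<close>, would lie in the other side, against
    \<open>none\<close>.\<close>
  have "open_interval C v u \<noteq> {}"
  proof
    assume empty: "open_interval C v u = {}"
    obtain e where e: "e \<in> edges C" "e \<noteq> {u, v}"
      using C2 by (metis card_2_iff' obtain_subset_with_card_n subsetD)
    obtain x y where xy: "x \<in> verts C" "y \<in> verts C" "x \<noteq> y" "e = {x, y}"
      using C e(1) by (rule edgeE)
    have "u \<notin> e" "v \<notin> e" using edges_at_minedge[OF min] e by auto
    then have "e \<subseteq> open_interval C u v"
      using order empty xy by (auto simp: open_interval_def)
    with none e show False by blast
  qed
  with min have empty: "open_interval C u v = {}" by (auto simp: minedge_def)
  define \<psi> where "\<psi> = \<phi>(u := a)"
  have \<phi>_pos: "0 < f (\<phi> x)" if "x \<in> verts C" "x \<noteq> u" for x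
    using pos[OF im] that inj\<phi> u \<phi>u by (metis inj_onD)
  \<comment> \<open>All images other than that of \<open>u\<close> have rank at least
    \<open>f b\<close>. Raising the image of \<open>u\<close> from rank 0 to
    \<open>f a < f b\<close> therefore leaves it the lowest, and no cyclic triple changes.\<close>
  have \<phi>_gt: "f a < f (\<phi> x)" if "x \<in> verts C" "x \<noteq> u" for x
  proof (cases "x = v")
    case False
    with order that empty have "cyc C v x u" by (auto simp: open_interval_def)
    then have "natural_cyc (f b) (f (\<phi> x)) (f w)"
      using ord u v that f b w im \<phi>u \<phi>v by metis
    then show ?thesis using fab by (auto simp: natural_cyc_def fw)
  qed (use fab \<phi>v in simp)
  have "contains H C"
    unfolding contains_def
  proof (intro exI[of _ \<psi>] conjI ballI impI)
    show "\<psi> ` verts C \<subseteq> verts H" using im a by (auto simp: \<psi>_def)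
    show "inj_on \<psi> (verts C)"
    proof (rule inj_onI)
      fix x y assume "x \<in> verts C" "y \<in> verts C" "\<psi> x = \<psi> y"
      then show "x = y"
        using \<phi>_gt[of x] \<phi>_gt[of y] inj\<phi> by (auto simp: \<psi>_def dest: inj_onD split: if_splits)
    qed
  next
    fix x y z assume xyz: "x \<in> verts C" "y \<in> verts C" "z \<in> verts C" "cyc C x y z"
    then have "natural_cyc (f (\<phi> x)) (f (\<phi> y)) (f (\<phi> z))"
      using ord f im by metis
    then have "natural_cyc (f (\<psi> x)) (f (\<psi> y)) (f (\<psi> z))"
      using \<phi>_gt[OF xyz(1)] \<phi>_gt[OF xyz(2)] \<phi>_gt[OF xyz(3)]
      by (auto simp: \<psi>_def natural_cyc_def \<phi>u fw)
    then show "cyc H (\<psi> x) (\<psi> y) (\<psi> z)"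
      using f xyz im a by (auto simp: \<psi>_def)
  next
    fix x y assume xy: "x \<in> verts C" "y \<in> verts C" "{x, y} \<in> edges C"
    show "{\<psi> x, \<psi> y} \<in> edges H"
    proof (cases "{x, y} = {u, v}")
      case True
      then show ?thesis using Eab uv \<phi>v by (auto simp: \<psi>_def doubleton_eq_iff insert_commute)
    next
      \<comment> \<open>By degree one, any other edge misses \<open>u\<close>, so its image misses
        \<open>w\<close> and already belongs to \<open>H\<close>.\<close>
      case False
      then have "x \<noteq> u" "y \<noteq> u" using edges_at_minedge[OF min xy(3)] by auto
      moreover from this have "w \<notin> {\<phi> x, \<phi> y}"
        using \<phi>_pos[OF xy(1)] \<phi>_pos[OF xy(2)] fw by auto
      ultimately show ?thesis using E\<phi>[OF xy] by (auto simp: \<psi>_def)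
    qed
  qed
  with av show False by simp
qed

text \<open>Without isolated vertices the edges cover all vertices, two per edge.\<close>

lemma card_verts_le_saturates:
  assumes "cyclically_ordered_graph C" "2 \<le> card (edges C)"
    and "\<And>u v. {u, v} \<in> edges C \<Longrightarrow> minedge C u v \<or> bisuperedge C u v"
    and H: "cyclically_ordered_graph H" and "2 \<le> card (verts H)" "saturates H C"
  shows "card (verts H) \<le> 2 * card (edges H)"
proof -
  have card2: "card e = 2" if "e \<in> edges H" for e
    using H that by (metis edgeE card_2_iff)
  have "verts H \<subseteq> \<Union>(edges H)"
    using no_isolated_vertex[OF assms] by auto
  moreover have "finite (\<Union>(edges H))"
    using finite_edges[OF H] card2 by (intro finite_Union) (auto intro: card_ge_0_finite)
  ultimately have "card (verts H) \<le> card (\<Union>(edges H))"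
    by (simp add: card_mono)
  also have "\<dots> \<le> sum card (edges H)"
    by (rule card_Union_le_sum_card)
  also have "\<dots> = 2 * card (edges H)"
    by (simp add: card2)
  finally show ?thesis .
qed

section \<open>Linear upper bound\<close>

lemma cyc_sat_le_if_minedge:
  fixes C :: "'a cograph"
  assumes C: "cyclically_ordered_graph C" and ab: "minedge C a b"
    and empty: "open_interval C a b = {}" and n: "card (verts C) \<le> n"
  shows "cyc_sat n C \<le> card (verts C) * n"
proof -
  define k where "k = card (verts C)"
  have Eab: "{a, b} \<in> edges C" using ab by (simp add: minedge_def)
  then obtain "a \<in> verts C" "b \<in> verts C" "a \<noteq> b"
    using C by (elim edgeE) (auto simp: doubleton_eq_iff)
  note V = this
  obtain f :: "'a \<Rightarrow> nat" where fa: "f a = 0" and inj: "inj_on f (verts C)"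
    and fk: "\<And>x. x \<in> verts C \<Longrightarrow> f x < k"
    and f: "\<And>x y z. x \<in> verts C \<Longrightarrow> y \<in> verts C \<Longrightarrow> z \<in> verts C \<Longrightarrow>
      cyc C x y z \<longleftrightarrow> natural_cyc (f x) (f y) (f z)"
    using C V(1) cyclic_order_rank unfolding cyclically_ordered_graph_def k_def by metis
  have fb: "0 < f b" using inj V fa by (metis gr0I inj_onD)
  \<comment> \<open>With the cut at \<open>a\<close> and nothing between \<open>a\<close> and
    \<open>b\<close>, these two come first in rank.\<close>
  have fx: "f b < f x" if "x \<in> verts C" "x \<noteq> a" "x \<noteq> b" for x
  proof -
    have "f x \<noteq> f a" "f x \<noteq> f b" using inj V that by (auto dest: inj_onD)
    moreover have "\<not> natural_cyc (f a) (f x) (f b)"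
      using empty f V that by (auto simp: open_interval_def)
    ultimately show ?thesis using fa by (auto simp: natural_cyc_def)
  qed
  \<comment> \<open>The shift puts \<open>C\<close> on the last \<open>k\<close> of the
    \<open>n\<close> positions. The vertices other than \<open>a\<close> and \<open>b\<close> have
    rank at least 2, hence land at \<open>n - k + 2\<close> or later, and everything before forms
    the gap.\<close>
  define g where "g x = n - k + f x" for x
  define H where "H = \<lparr>verts = {..<n}, cyc = natural_cyc,
    edges = (`) g ` (edges C - {{a, b}})\<rparr>"
  have gn: "g x < n" if "x \<in> verts C" for x
    using fk[OF that] n by (simp add: g_def k_def)
  have rest: "x \<in> verts C \<and> x \<noteq> a \<and> x \<noteq> b" if "x \<in> e" "e \<in> edges C - {{a, b}}" for x e
    using edges_at_minedge[OF ab] C that by (auto elim!: edgeE)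
  have H: "cyclically_ordered_graph H"
    unfolding cyclically_ordered_graph_def
  proof (intro conjI ballI)
    fix e assume "e \<in> edges H"
    then obtain e' where e': "e' \<in> edges C" "e = g ` e'" by (auto simp: H_def)
    obtain x y where xy: "x \<in> verts C" "y \<in> verts C" "x \<noteq> y" "e' = {x, y}"
      using C e'(1) by (rule edgeE)
    then have "g x \<noteq> g y" using inj by (auto simp: g_def dest: inj_onD)
    then show "\<exists>u\<in>verts H. \<exists>v\<in>verts H. u \<noteq> v \<and> e = {u, v}"
      using gn xy e' by (intro bexI[of _ "g x"] bexI[of _ "g y"]) (auto simp: H_def)
  qed (simp_all add: H_def cyclic_order_on_natural_cyc)
  have fin: "finite (edges C)" using C by (rule finite_edges)
  have "card (edges H) \<le> card (edges C - {{a, b}})"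
    unfolding H_def using fin by (simp add: card_image_le)
  also have "\<dots> < card (edges C)"
    using fin Eab by (rule card_Diff1_less)
  finally have "avoids H C"
    using card_edges_le_if_contains[OF C finite_edges[OF H]] by linarith
  with H obtain F where F: "edges H \<subseteq> F" and G: "cyclically_ordered_graph (H\<lparr>edges := F\<rparr>)"
    and sat: "saturates (H\<lparr>edges := F\<rparr>) C"
    by (rule saturated_extension)
  have gap: "{i, j} \<notin> F" if ij: "i < j" "j < n - k + 2" for i j
  proof
    assume ijF: "{i, j} \<in> F"
    \<comment> \<open>The pair \<open>i < j\<close> plays \<open>a\<close> and \<open>b\<close>:
      both lie before every position \<open>g x\<close> of the remaining vertices, so \<phi> is
      increasing in rank.\<close>
    define \<phi> where "\<phi> x = (if x = a then i else if x = b then j else g x)" for x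
    have mono: "\<phi> x < \<phi> y" if "f x < f y" "x \<in> verts C" "y \<in> verts C" for x y
      using fx[of x] fx[of y] that ij fa fb by (auto simp: \<phi>_def g_def)
    have "contains (H\<lparr>edges := F\<rparr>) C"
      unfolding contains_def
    proof (intro exI[of _ \<phi>] conjI ballI impI)
      \<comment> \<open>Guarantees \<open>n - k + 2 \<le> n\<close>, so the gap stays inside the
        vertex set.\<close>
      have "2 \<le> k"
        using card_mono[of "verts C" "{a, b}"] C V
        by (simp add: k_def cyclically_ordered_graph_def)
      then have "j < n" using ij n unfolding k_def by linarith
      then show "\<phi> ` verts C \<subseteq> verts (H\<lparr>edges := F\<rparr>)"
        using gn ij by (auto simp: \<phi>_def H_def)
      show "inj_on \<phi> (verts C)"
      proof (rule inj_onI)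
        fix x y assume xy: "x \<in> verts C" "y \<in> verts C" "\<phi> x = \<phi> y"
        then have "f x = f y"
          using mono[of x y] mono[of y x] by (metis less_irrefl nat_neq_iff)
        then show "x = y" using inj xy by (auto dest: inj_onD)
      qed
    next
      fix x y z assume xyz: "x \<in> verts C" "y \<in> verts C" "z \<in> verts C" "cyc C x y z"
      then have "natural_cyc (f x) (f y) (f z)" using f by blast
      then have "natural_cyc (\<phi> x) (\<phi> y) (\<phi> z)"
        using mono xyz unfolding natural_cyc_def by blast
      then show "cyc (H\<lparr>edges := F\<rparr>) (\<phi> x) (\<phi> y) (\<phi> z)"
        by (simp add: H_def)
    next
      fix x y assume xy: "x \<in> verts C" "y \<in> verts C" "{x, y} \<in> edges C"
      show "{\<phi> x, \<phi> y} \<in> edges (H\<lparr>edges := F\<rparr>)"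
      proof (cases "{x, y} = {a, b}")
        case True
        then show ?thesis
          using ijF V by (auto simp: \<phi>_def doubleton_eq_iff insert_commute)
      next
        case False
        with xy have e: "{x, y} \<in> edges C - {{a, b}}" by simp
        then have "{\<phi> x, \<phi> y} = g ` {x, y}"
          using rest[of x, OF _ e] rest[of y, OF _ e] by (simp add: \<phi>_def)
        moreover have "g ` {x, y} \<in> edges H" unfolding H_def cograph.simps using e by (rule imageI)
        ultimately show ?thesis using F by auto
      qed
    qed
    with sat show False by (simp add: saturates_def)
  qed
  \<comment> \<open>The at most \<open>k - 2\<close> positions outside the gap meet every edge of
    \<open>F\<close>.\<close>
  let ?S = "{n - k + 2..<n}"
  have "F \<subseteq> (\<lambda>(s, t). {s, t}) ` (?S \<times> {..<n})"
  proof
    fix e assume e: "e \<in> F"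
    then obtain x y where xy: "x < n" "y < n" "x \<noteq> y" "e = {x, y}"
      using G by (elim edgeE[of _ e]) (auto simp: H_def)
    then have "x \<in> ?S \<or> y \<in> ?S"
      using gap[of x y] gap[of y x] e
      by (metis atLeastLessThan_iff insert_commute not_le nat_neq_iff)
    then show "e \<in> (\<lambda>(s, t). {s, t}) ` (?S \<times> {..<n})"
      using xy by (auto simp: insert_commute)
  qed
  then have "card F \<le> card (?S \<times> {..<n})"
    by (rule surj_card_le[rotated]) simp
  also have "\<dots> = (n - (n - k + 2)) * n"
    by (simp add: card_cartesian_product)
  also have "\<dots> \<le> k * n"
    by (rule mult_right_mono) auto
  finally have "card F \<le> k * n" .
  moreover have "cyc_sat n C \<le> card F"
    unfolding cyc_sat_def using G sat
    by (intro Least_le exI[of _ "H\<lparr>edges := F\<rparr>"]) (simp add: H_def)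
  ultimately show ?thesis by (simp add: k_def)
qed

section \<open>Combining the two bounds\<close>

theorem theorem7:
  fixes C :: "'a cograph"
  assumes "cyclically_ordered_graph C"
    and "contains C L3"
    and "\<And>u v. {u, v} \<in> edges C \<Longrightarrow> minedge C u v \<or> bisuperedge C u v"
  shows "(\<lambda>n. real (cyc_sat n C)) \<in> \<Theta>(\<lambda>n. real n)"
proof (rule bigthetaI)
  have C3: "3 \<le> card (edges C)"
    using assms(1,2) by (rule card_edges_ge_3_if_contains_L3)
  then have ne: "edges C \<noteq> {}" by auto
  obtain u v where uv: "minedge C u v"
    using exists_edge_not_bisuperedge[OF assms(1) ne] assms(3) by metis
  \<comment> \<open>Swapping the endpoints if necessary puts the empty side clockwise from
    \<open>a\<close> to \<open>b\<close>.\<close>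
  then obtain a b where ab: "minedge C a b" "open_interval C a b = {}"
    using minedge_commute by (metis minedge_def)
  have "\<forall>\<^sub>F n in at_top. norm (real (cyc_sat n C)) \<le> real (card (verts C)) * norm (real n)"
    using eventually_ge_at_top[of "card (verts C)"]
  proof eventually_elim
    case (elim n)
    have "cyc_sat n C \<le> card (verts C) * n"
      using cyc_sat_le_if_minedge[OF assms(1) ab elim] .
    then show ?case by (simp flip: of_nat_mult)
  qed
  then show "(\<lambda>n. real (cyc_sat n C)) \<in> O(\<lambda>n. real n)"
    by (rule bigoI)
  have "\<forall>\<^sub>F n in at_top. norm (real n) \<le> 2 * norm (real (cyc_sat n C))"
    \<comment> \<open>A single vertex is saturating without any edge, so the lower bound starts at
      two vertices.\<close>
    using eventually_ge_at_top[of 2]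
  proof eventually_elim
    case (elim n)
    obtain H :: "nat cograph" where H: "cyclically_ordered_graph H" "card (verts H) = n"
      "saturates H C" "card (edges H) = cyc_sat n C"
      using cyc_sat_attained[OF assms(1) ne] by blast
    have "n \<le> 2 * cyc_sat n C"
      using card_verts_le_saturates[OF assms(1) _ assms(3) H(1) _ H(3)] C3 elim H by simp
    then show ?case by simp
  qed
  then show "(\<lambda>n. real (cyc_sat n C)) \<in> \<Omega>(\<lambda>n. real n)"
    unfolding bigomega_iff_bigo by (rule bigoI)
qed

end
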